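(* Let $G=G_1\times\cdots\times G_m$ and $H=H_1\times\cdots\times H_n$ be elementary Abelian groups, with primitive factors ordered so that $G=G_{\mathbb{Z}}\times G_{\mathbb{R}}\times G_F\times G_{\mathbb{T}}$ and $H=H_{\mathbb{Z}}\times H_{\mathbb{R}}\times H_F\times H_{\mathbb{T}}$. Let $c_j,c_j^*,d_i,d_i^*$ denote the characteristics of $G_j,G_j^*,H_i,H_i^*$ respectively. Let $\mathbf{Rep}$ be the group of all real $n\times m$ matrices that have integer coefficients in those rows $i$ for which $H_i$ has the form $\mathbb{Z}$ or $\mathbb{Z}_{d_i}$. A real $n\times m$ matrix $A$ is a valid matrix representation of some continuous group homomorphism $\alpha:G\to H$ if and only if $A$ is an element of $\mathbf{Rep}$ fulfilling the two (dual) sets of consistency conditions $$c_jA(i,j)=0 \bmod d_i,\qquad d_i^*A^*(j,i)=0\bmod c_j^*,$$ for every $i=1,\dots,n$, $j=1,\dots,m$, where $A^*=\Upsilon_G^{-1}A^T\Upsilon_H$ (an $m\times n$ matrix). Equivalently, $A$ must be of the form $$A=\begin{pmatrix} A_{\mathbb{Z}\mathbb{Z}} & 0 & 0 & 0 \\ A_{\mathbb{R}\mathbb{Z}} & A_{\mathbb{R}\mathbb{R}} & 0 & 0 \\ A_{F\mathbb{Z}} & 0 & A_{FF} & 0 \\ A_{\mathbb{T}\mathbb{Z}} & A_{\mathbb{T}\mathbb{R}} & A_{\mathbb{T}F} & A_{\mathbb{T}\mathbb{T}} \end{pmatrix}$$ (block $A_{XY}$ mapping $G_Y$ to $H_X$)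 with the following restrictions: 1. $A_{\mathbb{Z}\mathbb{Z}}$ and $A_{\mathbb{T}\mathbb{T}}$ are arbitrary integer matrices. 2. $A_{\mathbb{R}\mathbb{Z}}$, $A_{\mathbb{R}\mathbb{R}}$ are arbitrary real matrices. 3. $A_{F\mathbb{Z}}$, $A_{FF}$ are integer matrices: the first can be arbitrary; the coefficients of the second must be of the form $A(i,j)=\alpha_{i,j}\,\dfrac{d_i}{\gcd(d_i,c_j)}$, where the $\alpha_{i,j}$ can be arbitrary integers. 4. $A_{\mathbb{T}\mathbb{Z}}$, $A_{\mathbb{T}\mathbb{R}}$, $A_{\mathbb{T}F}$ are real matrices: the first two are arbitrary; the coefficients of the third are of the form $A(i,j)=\alpha_{i,j}/c_j$, where the $\alpha_{i,j}$ can be arbitrary integers.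
   Context: An elementary Abelian group is a product of primitive factors, each one of $\mathbb{Z}$, $\mathbb{R}$, $\mathbb{Z}_N=\{0,\dots,N-1\}$ (addition mod $N$), $\mathbb{T}=[0,1)$ (addition mod 1, circle topology); $G_{\mathbb{Z}},G_{\mathbb{R}},G_F,G_{\mathbb{T}}$ denote the products of the factors of type $\mathbb{Z}$, $\mathbb{R}$, finite cyclic, $\mathbb{T}$. Elements are viewed as real tuples. Characteristics: $\mathrm{char}(\mathbb{Z})=\mathrm{char}(\mathbb{R})=0$, $\mathrm{char}(\mathbb{Z}_N)=N$, $\mathrm{char}(\mathbb{T})=1$. Duals: $\mathbb{Z}^*=\mathbb{T}$, $\mathbb{T}^*=\mathbb{Z}$, $\mathbb{R}^*=\mathbb{R}$, $\mathbb{Z}_N^*=\mathbb{Z}_N$. For real numbers, $x=0\bmod c$ means $x\in c\mathbb{Z}$; in particular mod $0$ means equality. For $x\in\mathbb{R}^m$, $x\equiv g\pmod G$ means $x_i\equiv g_i\pmod{\mathrm{char}(G_i)}$ for all $i$. A matrix representation of $\alpha:G\to H$ is a real $n\times m$ matrix $A$ with $\alpha(g)\equiv Ax\pmod H$ for every $g\in G$ and every $x\in\mathbb{R}^m$ with $x\equiv g\pmod G$. For an elementary group $X$ with factors $X_1,\dots,X_k$, $\Upsilon_X$ is the diagonal $k\times k$ matrix with $\Upsilon_X(i,i)=1/N_i$ if $X_i=\mathbb{Z}_{N_i}$ and $\Upsilon_X(i,i)=1$ otherwise. *)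

theory Defs
  imports
    "HOL-Library.Real_Mod"
    "HOL-Algebra.Product_Groups"
    "HOL-Analysis.Function_Topology"
    "Jordan_Normal_Form.Gauss_Jordan_Elimination"
begin

section \<open>Elementary Abelian groups\<close>

text \<open>
  An elementary Abelian group is given by the list of its primitive factors. Indices start at 0.
  The modulus of a cyclic factor must be positive, see \<open>elementary\<close> below.
\<close>

datatype factor = Fac_Z | Fac_R | Fac_Zmod nat | Fac_T

definition elementary :: "factor list \<Rightarrow> bool" where
  "elementary G \<longleftrightarrow> (\<forall>N. Fac_Zmod N \<in> set G \<longrightarrow> 0 < N)"

fun char :: "factor \<Rightarrow> nat" where
  "char Fac_Z = 0"
| "char Fac_R = 0"
| "char (Fac_Zmod N) = N"
| "char Fac_T = 1"

fun dual :: "factor \<Rightarrow> factor" where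
  "dual Fac_Z = Fac_T"
| "dual Fac_R = Fac_R"
| "dual (Fac_Zmod N) = Fac_Zmod N"
| "dual Fac_T = Fac_Z"

fun factor_carrier :: "factor \<Rightarrow> real set" where
  "factor_carrier Fac_Z = \<int>"
| "factor_carrier Fac_R = UNIV"
| "factor_carrier (Fac_Zmod N) = real ` {..<N}"
| "factor_carrier Fac_T = {0..<1}"

text \<open>
  For real \<open>c \<ge> 0\<close>, \<open>[x = y] (rmod c)\<close> means that \<open>x - y\<close> is an integer multiple of \<open>c\<close>.
  In particular \<open>x rmod 0 = x\<close>, and congruence modulo \<open>0\<close> is equality.
\<close>

definition factor_group :: "factor \<Rightarrow> real monoid" where
  "factor_group X =
     \<lparr>carrier = factor_carrier X, monoid.mult = (\<lambda>x y. (x + y) rmod real (char X)), one = 0\<rparr>"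

text \<open>
  The circle topology on \<open>[0,1)\<close> is the one that makes the bijection \<open>x \<mapsto> exp (2 \<pi> i x)\<close>
  onto the complex unit circle a homeomorphism.
\<close>

fun factor_topology :: "factor \<Rightarrow> real topology" where
  "factor_topology Fac_Z = discrete_topology (factor_carrier Fac_Z)"
| "factor_topology Fac_R = euclideanreal"
| "factor_topology (Fac_Zmod N) = discrete_topology (factor_carrier (Fac_Zmod N))"
| "factor_topology Fac_T =
     pullback_topology (factor_carrier Fac_T) (\<lambda>x. cis (2 * pi * x)) euclidean"

definition elem_group :: "factor list \<Rightarrow> (nat \<Rightarrow> real) monoid" where
  "elem_group G = product_group {..<length G} (\<lambda>i. factor_group (G ! i))"

definition elem_topology :: "factor list \<Rightarrow> (nat \<Rightarrow> real) topology" where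
  "elem_topology G = product_topology (\<lambda>i. factor_topology (G ! i)) {..<length G}"

lemma topspace_factor_topology: "topspace (factor_topology X) = factor_carrier X"
  by (cases X) (auto simp: topspace_pullback_topology)

lemma topspace_elem_topology: "topspace (elem_topology G) = carrier (elem_group G)"
  by (simp add: elem_topology_def elem_group_def factor_group_def topspace_factor_topology)

definition Z_part :: "factor list \<Rightarrow> factor list" where
  "Z_part G = filter (\<lambda>X. X = Fac_Z) G"

definition R_part :: "factor list \<Rightarrow> factor list" where
  "R_part G = filter (\<lambda>X. X = Fac_R) G"

definition F_part :: "factor list \<Rightarrow> factor list" where
  "F_part G = filter (\<lambda>X. \<exists>N. X = Fac_Zmod N) G"

definition T_part :: "factor list \<Rightarrow> factor list" where
  "T_part G = filter (\<lambda>X. X = Fac_T) G"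

definition ordered_factors :: "factor list \<Rightarrow> bool" where
  "ordered_factors G \<longleftrightarrow> G = Z_part G @ R_part G @ F_part G @ T_part G"


section \<open>Matrix representations\<close>

definition tuple_cong :: "factor list \<Rightarrow> (nat \<Rightarrow> real) \<Rightarrow> (nat \<Rightarrow> real) \<Rightarrow> bool" where
  "tuple_cong G x g \<longleftrightarrow> (\<forall>i<length G. [x i = g i] (rmod real (char (G ! i))))"

definition continuous_hom :: "factor list \<Rightarrow> factor list \<Rightarrow> ((nat \<Rightarrow> real) \<Rightarrow> (nat \<Rightarrow> real)) \<Rightarrow> bool" where
  "continuous_hom G H \<alpha> \<longleftrightarrow>
     \<alpha> \<in> hom (elem_group G) (elem_group H) \<and>
     continuous_map (elem_topology G) (elem_topology H) \<alpha>"

definition matrix_rep ::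
  "factor list \<Rightarrow> factor list \<Rightarrow> ((nat \<Rightarrow> real) \<Rightarrow> (nat \<Rightarrow> real)) \<Rightarrow> real mat \<Rightarrow> bool" where
  "matrix_rep G H \<alpha> A \<longleftrightarrow>
     A \<in> carrier_mat (length H) (length G) \<and>
     (\<forall>g \<in> carrier (elem_group G). \<forall>x \<in> carrier_vec (length G).
        tuple_cong G (vec_index x) g \<longrightarrow> tuple_cong H (\<alpha> g) (vec_index (A *\<^sub>v x)))"

definition Rep :: "factor list \<Rightarrow> factor list \<Rightarrow> real mat set" where
  "Rep G H =
     {A \<in> carrier_mat (length H) (length G).
        \<forall>i<length H. (H ! i = Fac_Z \<or> (\<exists>N. H ! i = Fac_Zmod N)) \<longrightarrow>
          (\<forall>j<length G. A $$ (i, j) \<in> \<int>)}"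

fun Upsilon_entry :: "factor \<Rightarrow> real" where
  "Upsilon_entry (Fac_Zmod N) = 1 / real N"
| "Upsilon_entry _ = 1"

definition Upsilon :: "factor list \<Rightarrow> real mat" where
  "Upsilon X = mat_diag (length X) (\<lambda>i. Upsilon_entry (X ! i))"

definition dual_mat :: "factor list \<Rightarrow> factor list \<Rightarrow> real mat \<Rightarrow> real mat" where
  "dual_mat G H A = the (mat_inverse (Upsilon G)) * transpose_mat A * Upsilon H"

definition consistent :: "factor list \<Rightarrow> factor list \<Rightarrow> real mat \<Rightarrow> bool" where
  "consistent G H A \<longleftrightarrow>
     (\<forall>i<length H. \<forall>j<length G.
        [real (char (G ! j)) * A $$ (i, j) = 0] (rmod real (char (H ! i))) \<and>
        [real (char (dual (H ! i))) * dual_mat G H A $$ (j, i) = 0]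
          (rmod real (char (dual (G ! j)))))"

definition normal_form :: "factor list \<Rightarrow> factor list \<Rightarrow> real mat \<Rightarrow> bool" where
  "normal_form G H A \<longleftrightarrow>
    (let gZ = length (Z_part G); gR = length (R_part G); gF = length (F_part G); gT = length (T_part G);
         hZ = length (Z_part H); hR = length (R_part H); hF = length (F_part H); hT = length (T_part H)
     in \<exists>A_ZZ \<in> carrier_mat hZ gZ.
        \<exists>A_RZ \<in> carrier_mat hR gZ. \<exists>A_RR \<in> carrier_mat hR gR.
        \<exists>A_FZ \<in> carrier_mat hF gZ. \<exists>A_FF \<in> carrier_mat hF gF.
        \<exists>A_TZ \<in> carrier_mat hT gZ. \<exists>A_TR \<in> carrier_mat hT gR.
        \<exists>A_TF \<in> carrier_mat hT gF. \<exists>A_TT \<in> carrier_mat hT gT.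
          A = four_block_mat
                (four_block_mat A_ZZ (0\<^sub>m hZ gR)
                                A_RZ A_RR)
                (four_block_mat (0\<^sub>m hZ gF) (0\<^sub>m hZ gT)
                                (0\<^sub>m hR gF) (0\<^sub>m hR gT))
                (four_block_mat A_FZ (0\<^sub>m hF gR)
                                A_TZ A_TR)
                (four_block_mat A_FF (0\<^sub>m hF gT)
                                A_TF A_TT) \<and>
          elements_mat A_ZZ \<subseteq> \<int> \<and> elements_mat A_TT \<subseteq> \<int> \<and>
          elements_mat A_FZ \<subseteq> \<int> \<and>
          (\<exists>\<alpha> :: nat \<Rightarrow> nat \<Rightarrow> int. \<forall>i<hF. \<forall>j<gF.
             A_FF $$ (i, j) =
               of_int (\<alpha> i j) * (real (char (F_part H ! i)) /
                 real (gcd (char (F_part H ! i)) (char (F_part G ! j))))) \<and>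
          (\<exists>\<alpha> :: nat \<Rightarrow> nat \<Rightarrow> int. \<forall>i<hT. \<forall>j<gF.
             A_TF $$ (i, j) = of_int (\<alpha> i j) / real (char (F_part G ! j))))"


section \<open>Well-definedness\<close>

lemma factor_carrier_rmod:
  assumes "x \<in> factor_carrier X" "elementary [X]"
  shows "x rmod real (char X) = x"
  using assms by (cases X) (auto simp: elementary_def)

lemma rmod_in_factor_carrier:
  assumes "elementary [X]" "X = Fac_Z \<or> (\<exists>N. X = Fac_Zmod N) \<Longrightarrow> x \<in> \<int>"
  shows "x rmod real (char X) \<in> factor_carrier X"
proof (cases X)
  case (Fac_Zmod N)
  with assms obtain k where k: "x = of_int k" and N: "N > 0"
    by (auto simp: elementary_def elim: Ints_cases)
  define r where "r = nat (k mod int N)"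
  have r: "int r = k mod int N" "r < N"
    using N by (simp_all add: r_def nat_less_iff)
  have "k = int r + k div int N * int N"
    using r(1) by simp
  then have "x = real r + real_of_int (k div int N) * real N"
    unfolding k by (metis of_int_add of_int_mult of_int_of_nat_eq)
  then have "x rmod real N = real r"
    by (rule rmod_unique[rotated]) (use r(2) in simp)
  then show ?thesis
    using r(2) Fac_Zmod by simp
qed (use assms in \<open>auto simp: rmod_less rmod_nonneg\<close>)

lemma comm_group_factor_group:
  assumes X: "elementary [X]"
  shows "comm_group (factor_group X)"
proof (rule comm_groupI)
  have Int: "x \<in> \<int>" if "x \<in> factor_carrier X" "X = Fac_Z \<or> (\<exists>N. X = Fac_Zmod N)" for x
    using that by auto
  fix x y z assume x: "x \<in> carrier (factor_group X)" and y: "y \<in> carrier (factor_group X)"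
    and z: "z \<in> carrier (factor_group X)"
  let ?c = "real (char X)"
  show "x \<otimes>\<^bsub>factor_group X\<^esub> y \<in> carrier (factor_group X)"
    using x y Int[of x] Int[of y] rmod_in_factor_carrier[OF X, of "x + y"]
    by (simp add: factor_group_def)
  have "((x + y) rmod ?c + z) rmod ?c = (x + (y + z) rmod ?c) rmod ?c"
    by (metis rmod_add rmod_rmod add.assoc)
  then show "x \<otimes>\<^bsub>factor_group X\<^esub> y \<otimes>\<^bsub>factor_group X\<^esub> z =
        x \<otimes>\<^bsub>factor_group X\<^esub> (y \<otimes>\<^bsub>factor_group X\<^esub> z)"
    by (simp add: factor_group_def)
  show "x \<otimes>\<^bsub>factor_group X\<^esub> y = y \<otimes>\<^bsub>factor_group X\<^esub> x"
    by (simp add: factor_group_def add.commute)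
  show "\<one>\<^bsub>factor_group X\<^esub> \<otimes>\<^bsub>factor_group X\<^esub> x = x"
    using x X by (simp add: factor_group_def factor_carrier_rmod)
  have "(- x) rmod ?c \<in> factor_carrier X"
    using x Int[of x] rmod_in_factor_carrier[OF X, of "- x"]
    by (simp add: factor_group_def)
  moreover have "((- x) rmod ?c + x) rmod ?c = 0"
    by (metis rmod_add rmod_rmod add.left_inverse rmod_0)
  ultimately show "\<exists>y\<in>carrier (factor_group X). y \<otimes>\<^bsub>factor_group X\<^esub> x = \<one>\<^bsub>factor_group X\<^esub>"
    by (auto simp: factor_group_def)
next
  have "0 rmod real (char X) \<in> factor_carrier X"
    by (rule rmod_in_factor_carrier[OF X]) auto
  then show "\<one>\<^bsub>factor_group X\<^esub> \<in> carrier (factor_group X)"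
    by (simp add: factor_group_def)
qed

lemma comm_group_elem_group:
  assumes "elementary G"
  shows "comm_group (elem_group G)"
proof -
  have *: "comm_group (factor_group (G ! i))" if "i < length G" for i
    using assms that nth_mem[OF that]
    by (intro comm_group_factor_group) (auto simp: elementary_def)
  have "group (elem_group G)"
    unfolding elem_group_def
    by (rule product_group) (use * in \<open>auto simp: comm_group_def\<close>)
  then show ?thesis
    by (rule group.group_comm_groupI)
       (auto simp: elem_group_def fun_eq_iff PiE_iff factor_group_def add.commute)
qed

lemma subgroup_Rep: "subgroup (Rep G H) (monoid_mat TYPE(real) (length H) (length G))"
proof -
  let ?M = "monoid_mat TYPE(real) (length H) (length G)"
  have M: "group ?M"
    using comm_group_mat by (auto simp: comm_group_def)
  show ?thesis
  proof (rule group.subgroupI[OF M])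
    show "Rep G H \<subseteq> carrier ?M"
      by (auto simp: Rep_def monoid_mat_def)
    show "Rep G H \<noteq> {}"
      by (rule ex_in_conv[THEN iffD1], rule exI[of _ "0\<^sub>m (length H) (length G)"])
         (auto simp: Rep_def)
    fix A assume A: "A \<in> Rep G H"
    have "inv\<^bsub>?M\<^esub> A = - A"
      by (rule group.inv_equality[OF M])
         (use A in \<open>auto simp: Rep_def monoid_mat_def\<close>)
    then show "inv\<^bsub>?M\<^esub> A \<in> Rep G H"
      using A by (auto simp: Rep_def)
    fix B assume B: "B \<in> Rep G H"
    then show "A \<otimes>\<^bsub>?M\<^esub> B \<in> Rep G H"
      using A by (auto simp: Rep_def monoid_mat_def)
  qed
qed

text \<open>\<open>Upsilon G\<close> is invertible, so the use of \<open>the\<close> in \<open>dual_mat\<close> is harmless.\<close>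

lemma mat_inverse_Upsilon:
  assumes "elementary G"
  shows "mat_inverse (Upsilon G) = Some (mat_diag (length G) (\<lambda>i. 1 / Upsilon_entry (G ! i)))"
proof -
  let ?n = "length G" and ?U = "Upsilon G"
  let ?D = "mat_diag ?n (\<lambda>i. 1 / Upsilon_entry (G ! i))"
  have U: "?U \<in> carrier_mat ?n ?n" and D: "?D \<in> carrier_mat ?n ?n"
    by (auto simp: Upsilon_def)
  have nz: "Upsilon_entry (G ! i) \<noteq> 0" if "i < ?n" for i
    using assms nth_mem[OF that] by (cases "G ! i") (auto simp: elementary_def)
  have UD: "?U * ?D = 1\<^sub>m ?n" and DU: "?D * ?U = 1\<^sub>m ?n"
    unfolding Upsilon_def mat_diag_diag by (auto simp: mat_diag_def nz intro!: eq_matI)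
  have "?U \<in> Units (ring_mat TYPE(real) ?n ())"
    using U D UD DU by (auto simp: Units_def ring_mat_def)
  then obtain B where B: "mat_inverse ?U = Some B"
    using mat_inverse(1)[OF U] by fastforce
  with mat_inverse(2)[OF U B] have "?U * B = 1\<^sub>m ?n" and Bc: "B \<in> carrier_mat ?n ?n"
    by auto
  then have "B = ?D"
    using assoc_mult_mat[OF D U Bc] DU D by simp
  with B show ?thesis by simp
qed

end

theory Submission
  imports Defs "HOL-Analysis.Product_Topology"
begin

text \<open>
  All conditions decouple over the matrix entries: each of them says that every entry \<open>a\<close> from a
  factor \<open>Y\<close> to a factor \<open>X\<close> is integral if \<open>X\<close> is discrete, vanishes if moreover \<open>Y\<close> is
  \<open>\<real>\<close> or \<open>\<T>\<close>, and satisfies \<open>char Y * a = 0\<close> modulo \<open>char X\<close>.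
  Necessity follows by evaluating a represented homomorphism on real multiples \<open>t e\<^sub>j\<close> of the unit
  vectors: \<open>t = char Y\<close> represents \<open>0\<close>, and \<open>t * a\<close> must be an integer for every admitted \<open>t\<close>
  if \<open>X\<close> is discrete. Conversely, the conditions make \<open>y \<mapsto> a * y\<close> well defined modulo
  \<open>char X\<close>, and continuity passes to sums because addition in a factor is continuous.
\<close>

section \<open>The condition on a single coefficient between two factors\<close>

definition discrete_factor :: "factor \<Rightarrow> bool" where
  "discrete_factor X \<longleftrightarrow> X = Fac_Z \<or> (\<exists>N. X = Fac_Zmod N)"

lemma discrete_factor_simps [simp]:
  "discrete_factor Fac_Z" "discrete_factor (Fac_Zmod N)"
  "\<not> discrete_factor Fac_R" "\<not> discrete_factor Fac_T"
  by (auto simp: discrete_factor_def)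

text \<open>\<open>X\<close> is the target and \<open>Y\<close> the source, matching row and column.
  The second conjunct reflects that a continuous homomorphism from a connected group to a discrete
  one is trivial; the third lets multiplication by \<open>a\<close> descend modulo the
  characteristics.\<close>

definition admissible :: "factor \<Rightarrow> factor \<Rightarrow> real \<Rightarrow> bool" where
  "admissible X Y a \<longleftrightarrow>
     (discrete_factor X \<longrightarrow> a \<in> \<int>) \<and>
     (discrete_factor X \<and> \<not> discrete_factor Y \<longrightarrow> a = 0) \<and>
     [real (char Y) * a = 0] (rmod real (char X))"

lemma rcong_0_iff_multiple: "[x = 0] (rmod m) \<longleftrightarrow> (\<exists>k. x = of_int k * m)"
proof -
  have "[x = 0] (rmod m) \<longleftrightarrow> [0 = x] (rmod m)" by (rule rcong_sym_iff)
  then show ?thesis by (simp add: rcong_altdef)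
qed

lemma rcong_0_1_iff: "[x = 0] (rmod 1) \<longleftrightarrow> x \<in> \<int>"
  by (auto simp: rcong_0_iff_multiple elim: Ints_cases)

text \<open>For discrete \<open>X\<close> the factor \<open>char (dual X) * Upsilon_entry X\<close>
  is 1, so the dual condition is \<open>a / Upsilon_entry Y = 0\<close> modulo
  \<open>char (dual Y)\<close>: integrality of \<open>a\<close> if \<open>Y\<close> is discrete, and
  \<open>a = 0\<close> otherwise. For the other \<open>X\<close>, \<open>char (dual X)\<close> is 0
  or the entries are unscaled integers' duals with characteristic 0, so the dual condition is
  vacuous.\<close>

lemma consistency_iff_admissible:
  assumes "elementary [X]" "elementary [Y]"
  shows "(discrete_factor X \<longrightarrow> a \<in> \<int>) \<and>
         [real (char Y) * a = 0] (rmod real (char X)) \<and>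
         [real (char (dual X)) * (1 / Upsilon_entry Y * a * Upsilon_entry X) = 0]
           (rmod real (char (dual Y))) \<longleftrightarrow> admissible X Y a"
proof (cases "discrete_factor X")
  case True
  then have "real (char (dual X)) * Upsilon_entry X = 1"
    using assms(1) by (auto simp: discrete_factor_def elementary_def)
  then have *: "real (char (dual X)) * (1 / Upsilon_entry Y * a * Upsilon_entry X) = a / Upsilon_entry Y"
    by (metis mult.assoc mult.commute mult.left_neutral times_divide_eq_left)
  show ?thesis
    unfolding * using True assms(2)
    by (cases Y) (auto simp: admissible_def elementary_def rcong_0_1_iff rcong_0_iff_multiple elim: Ints_cases)
next
  case False
  then show ?thesis
    by (cases X) (auto simp: admissible_def)
qed

text \<open>Dividing both moduli by their gcd leaves coprime \<open>p\<close> and \<open>q\<close>.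
  For an integer \<open>z\<close>, the congruence becomes \<open>q * z = k * p\<close>, which forces
  \<open>p\<close> to divide \<open>z\<close>.\<close>

lemma int_multiple_mult_iff:
  fixes M N :: nat
  assumes "0 < M" "0 < N"
  shows "a \<in> \<int> \<and> [real N * a = 0] (rmod real M) \<longleftrightarrow>
    (\<exists>k::int. a = of_int k * (real M / real (gcd M N)))"
proof -
  define g where "g = gcd M N"
  define p q where "p = M div g" and "q = N div g"
  have g: "0 < g" and M: "M = p * g" and N: "N = q * g"
    using assms by (auto simp: g_def p_def q_def)
  have cop: "coprime (int p) (int q)"
    using assms div_gcd_coprime[of M N] by (auto simp: p_def q_def g_def)
  have Mg: "real M / real g = real p"
    using g by (simp add: M)
  have "a \<in> \<int> \<and> [real N * a = 0] (rmod real M) \<longleftrightarrow> (\<exists>k::int. a = of_int k * real p)"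
  proof
    assume "a \<in> \<int> \<and> [real N * a = 0] (rmod real M)"
    then obtain z k where z: "a = of_int z" and "real N * a = of_int k * real M"
      by (auto simp: rcong_0_iff_multiple elim!: Ints_cases)
    then have "of_int (int q * z) = (of_int (k * int p) :: real)"
      using g by (simp add: M N)
    then have "int q * z = k * int p"
      by (simp only: of_int_eq_iff)
    then have "int p dvd z"
      using cop by (metis coprime_dvd_mult_right_iff dvd_triv_right)
    then show "\<exists>k::int. a = of_int k * real p"
      by (auto simp: z mult.commute)
  next
    assume "\<exists>k::int. a = of_int k * real p"
    then obtain k :: int where k: "a = of_int k * real p" ..
    have "real N * a = of_int (int q * k) * real M"
      by (simp add: k M N)
    then have "[real N * a = 0] (rmod real M)"
      unfolding rcong_0_iff_multiple by blast
    then show "a \<in> \<int> \<and> [real N * a = 0] (rmod real M)"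
      by (simp add: k)
  qed
  then show ?thesis
    by (simp add: Mg flip: g_def)
qed

lemma admissible_finite_finite [simp]:
  assumes "0 < M" "0 < N"
  shows "admissible (Fac_Zmod M) (Fac_Zmod N) a \<longleftrightarrow>
    (\<exists>k::int. a = of_int k * (real M / real (gcd M N)))"
  unfolding int_multiple_mult_iff[OF assms, symmetric] by (auto simp: admissible_def)

lemma admissible_T_finite [simp]:
  assumes "0 < N"
  shows "admissible Fac_T (Fac_Zmod N) a \<longleftrightarrow> (\<exists>k::int. a = of_int k / real N)"
  using assms by (simp add: admissible_def rcong_0_iff_multiple field_simps)

text \<open>With the two preceding rules this covers all sixteen pairs of factor types, one for each
  block of the normal form.\<close>

lemma admissible_simps [simp]:
  "admissible Fac_Z Fac_Z a \<longleftrightarrow> a \<in> \<int>"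
  "admissible Fac_Z Fac_R a \<longleftrightarrow> a = 0"
  "0 < N \<Longrightarrow> admissible Fac_Z (Fac_Zmod N) a \<longleftrightarrow> a = 0"
  "admissible Fac_Z Fac_T a \<longleftrightarrow> a = 0"
  "admissible Fac_R Fac_Z a"
  "admissible Fac_R Fac_R a"
  "0 < N \<Longrightarrow> admissible Fac_R (Fac_Zmod N) a \<longleftrightarrow> a = 0"
  "admissible Fac_R Fac_T a \<longleftrightarrow> a = 0"
  "admissible (Fac_Zmod M) Fac_Z a \<longleftrightarrow> a \<in> \<int>"
  "admissible (Fac_Zmod M) Fac_R a \<longleftrightarrow> a = 0"
  "admissible (Fac_Zmod M) Fac_T a \<longleftrightarrow> a = 0"
  "admissible Fac_T Fac_Z a"
  "admissible Fac_T Fac_R a"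
  "admissible Fac_T Fac_T a \<longleftrightarrow> a \<in> \<int>"
  by (auto simp: admissible_def rcong_0_1_iff)

section \<open>From matrix conditions to entrywise conditions\<close>

lemma dual_mat_index:
  assumes "elementary G" "A \<in> carrier_mat (length H) (length G)" "i < length H" "j < length G"
  shows "dual_mat G H A $$ (j, i) =
    1 / Upsilon_entry (G ! j) * A $$ (i, j) * Upsilon_entry (H ! i)"
proof -
  let ?B = "mat_diag (length G) (\<lambda>i. 1 / Upsilon_entry (G ! i)) * transpose_mat A"
  have T: "transpose_mat A \<in> carrier_mat (length G) (length H)"
    using assms(2) by simp
  then have "?B \<in> carrier_mat (length G) (length H)"
    by (simp add: mat_diag_mult_left[OF T])
  then show ?thesis
    using assms unfolding dual_mat_def mat_inverse_Upsilon[OF assms(1)]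
    unfolding Upsilon_def
    by (simp add: mat_diag_mult_right[where nr = "length G"] mat_diag_mult_left[OF T])
qed

lemma elementary_nth: "elementary G \<Longrightarrow> i < length G \<Longrightarrow> elementary [G ! i]"
  by (auto simp: elementary_def)

lemma Rep_consistent_iff_admissible:
  assumes "elementary G" "elementary H" "A \<in> carrier_mat (length H) (length G)"
  shows "A \<in> Rep G H \<and> consistent G H A \<longleftrightarrow>
    (\<forall>i<length H. \<forall>j<length G. admissible (H ! i) (G ! j) (A $$ (i, j)))"
proof -
  have "A \<in> Rep G H \<and> consistent G H A \<longleftrightarrow>
    (\<forall>i<length H. \<forall>j<length G.
       (discrete_factor (H ! i) \<longrightarrow> A $$ (i, j) \<in> \<int>) \<and>
       [real (char (G ! j)) * A $$ (i, j) = 0] (rmod real (char (H ! i))) \<and>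
       [real (char (dual (H ! i))) *
          (1 / Upsilon_entry (G ! j) * A $$ (i, j) * Upsilon_entry (H ! i)) = 0]
         (rmod real (char (dual (G ! j)))))"
    using assms(3) unfolding Rep_def consistent_def discrete_factor_def
    by (simp add: dual_mat_index[OF assms(1,3)]) blast
  then show ?thesis
    by (simp only: consistency_iff_admissible elementary_nth[OF assms(1)] elementary_nth[OF assms(2)]
          cong: all_cong)
qed

section \<open>Multiplication by an admissible coefficient\<close>

text \<open>Shifting the argument by \<open>n * char Y\<close> shifts the product by
  \<open>n * (char Y * a)\<close>, a multiple of \<open>char X\<close> by admissibility.\<close>

lemma admissible_rcong_mult:
  assumes "admissible X Y a" "[x = y] (rmod real (char Y))"
  shows "[a * x = a * y] (rmod real (char X))"
proof -
  obtain n where "y = x + of_int n * real (char Y)"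
    using assms(2) by (auto simp: rcong_altdef)
  moreover obtain k where "real (char Y) * a = of_int k * real (char X)"
    using assms(1) by (auto simp: admissible_def rcong_0_iff_multiple)
  ultimately have "a * y = a * x + of_int (n * k) * real (char X)"
    by (simp add: algebra_simps)
  then show ?thesis
    by (auto simp only: rcong_altdef)
qed

lemma admissible_mult_Ints:
  assumes "admissible X Y a" "discrete_factor X" "x \<in> factor_carrier Y"
  shows "a * x \<in> \<int>"
proof (cases "discrete_factor Y")
  case True
  then have "x \<in> \<int>" using assms(3) by (auto simp: discrete_factor_def)
  then show ?thesis using assms by (simp add: admissible_def)
qed (use assms in \<open>simp add: admissible_def\<close>)

lemma rcong_sum:
  assumes "\<And>j. j \<in> S \<Longrightarrow> [f j = g j] (rmod m)"
  shows "[sum f S = sum g S] (rmod m)"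
  using assms by (induction S rule: infinite_finite_induct) (auto intro: rcong_add)

lemma rcong_imp_rmod_eq: "[x = y] (rmod m) \<Longrightarrow> x rmod m = y rmod m"
  by (simp add: rcong_def)

section \<open>Continuity of addition and multiplication in the factors\<close>

lemma cis_2pi_rmod_1 [simp]: "cis (2 * pi * (x rmod 1)) = cis (2 * pi * x)"
proof -
  have "[x rmod 1 = x] (rmod 1)" by (simp add: rcong_def)
  moreover define y where "y = x rmod 1"
  ultimately obtain n where "x = y + of_int n" by (auto simp: rcong_altdef)
  then have "2 * pi * x = 2 * pi * y + of_int n * (2 * pi)"
    by (simp add: algebra_simps)
  then show ?thesis unfolding cis_eq_iff rcong_altdef y_def by blast
qed

text \<open>The circle topology is pulled back along \<open>cis\<close>, so continuity is tested
  after applying \<open>cis\<close>, which does not see the reduction modulo 1.\<close>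

lemma continuous_map_into_factor_T:
  assumes "continuous_map T euclidean (\<lambda>x. cis (2 * pi * f x))"
  shows "continuous_map T (factor_topology Fac_T) (\<lambda>x. f x rmod 1)"
  using assms by (auto intro!: continuous_map_pullback' simp: o_def rmod_less rmod_nonneg)

lemma continuous_map_from_factor_T:
  assumes "continuous_map T (factor_topology Fac_T) f"
  shows "continuous_map T euclidean (\<lambda>x. cis (2 * pi * f x))"
proof -
  have "continuous_map (factor_topology Fac_T) euclidean (id \<circ> (\<lambda>x. cis (2 * pi * x)))"
    unfolding factor_topology.simps by (rule continuous_map_pullback) simp
  from continuous_map_compose[OF assms this] show ?thesis by (simp add: o_def)
qed

lemma factor_topology_discrete:
  "discrete_factor X \<Longrightarrow> factor_topology X = discrete_topology (factor_carrier X)"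
  by (auto simp: discrete_factor_def)

text \<open>For discrete \<open>X\<close> the pair of maps lands in a discrete product, on which
  every map is continuous. On the circle, \<open>cis\<close> turns addition into complex
  multiplication.\<close>

lemma continuous_map_factor_add:
  assumes X: "elementary [X]"
    and f: "continuous_map T (factor_topology X) f" and g: "continuous_map T (factor_topology X) g"
  shows "continuous_map T (factor_topology X) (\<lambda>x. (f x + g x) rmod real (char X))"
proof (cases "discrete_factor X")
  case True
  have "continuous_map (discrete_topology (factor_carrier X \<times> factor_carrier X)) (factor_topology X)
          (\<lambda>(u, v). (u + v) rmod real (char X))"
    using True by (auto simp: topspace_factor_topology discrete_factor_def
        intro!: rmod_in_factor_carrier[OF X])
  moreover have "continuous_map T (discrete_topology (factor_carrier X \<times> factor_carrier X)) (\<lambda>x. (f x, g x))"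
    using f g True
    by (simp add: prod_topology_discrete_topology factor_topology_discrete continuous_map_pairedI)
  ultimately show ?thesis
    by (auto dest: continuous_map_compose simp: o_def)
next
  case False
  then consider "X = Fac_R" | "X = Fac_T" by (cases X) auto
  then show ?thesis
  proof cases
    case 1
    with f g show ?thesis by (auto intro: continuous_map_add)
  next
    case 2
    have "continuous_map T (prod_topology euclidean euclidean) (\<lambda>x. (cis (2 * pi * f x), cis (2 * pi * g x)))"
      using f g 2 by (intro continuous_map_pairedI continuous_map_from_factor_T) auto
    moreover have "continuous_map (prod_topology euclidean euclidean) euclidean (\<lambda>(z, w::complex). z * w)"
      by (auto intro!: continuous_intros simp: case_prod_unfold)
    ultimately have "continuous_map T euclidean
        ((\<lambda>(z, w). z * w) \<circ> (\<lambda>x. (cis (2 * pi * f x), cis (2 * pi * g x))))"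
      by (rule continuous_map_compose)
    then have "continuous_map T euclidean (\<lambda>x. cis (2 * pi * (f x + g x)))"
      by (simp add: o_def cis_mult distrib_left)
    then show ?thesis
      using 2 continuous_map_into_factor_T by simp
  qed
qed

text \<open>A discrete source or \<open>a = 0\<close> makes continuity immediate. Otherwise the
  target is the line or the circle; on the circle, multiplication by an integer \<open>n\<close>
  becomes the power map \<open>z powi n\<close>.\<close>

lemma continuous_map_factor_mult:
  assumes X: "elementary [X]" and Y: "elementary [Y]" and a: "admissible X Y a"
  shows "continuous_map (factor_topology Y) (factor_topology X) (\<lambda>y. (a * y) rmod real (char X))"
proof (cases "a = 0 \<or> discrete_factor Y")
  case True
  have mem: "(a * y) rmod real (char X) \<in> factor_carrier X" if "y \<in> factor_carrier Y" for y
    using admissible_mult_Ints[OF a _ that]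
    by (intro rmod_in_factor_carrier[OF X]) (auto simp: discrete_factor_def)
  show ?thesis
  proof (cases "discrete_factor Y")
    case True
    then show ?thesis
      using mem by (auto simp: factor_topology_discrete topspace_factor_topology)
  next
    case False
    \<comment> \<open>Here \<open>a = 0\<close>, so the map is constantly 0 and only membership of
      its value remains.\<close>
    have "0 \<in> factor_carrier X"
      using rmod_in_factor_carrier[OF X, of 0] by simp
    with False True show ?thesis by (simp add: topspace_factor_topology)
  qed
next
  case False
  then have "\<not> discrete_factor X" using a by (auto simp: admissible_def)
  with False a consider "X = Fac_R" "Y = Fac_R" | "X = Fac_T" "Y = Fac_R" | "X = Fac_T" "Y = Fac_T" "a \<in> \<int>"
    by (cases X; cases Y) auto
  then show ?thesis
  proof cases
    case 1
    then show ?thesis by (auto intro!: continuous_intros)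
  next
    case 2
    have "continuous_map euclideanreal euclidean (\<lambda>x. cis (2 * pi * (a * x)))"
      by (auto intro!: continuous_intros)
    from continuous_map_into_factor_T[OF this] show ?thesis
      using 2 by simp
  next
    case 3
    then obtain n where n: "a = of_int n" by (auto elim: Ints_cases)
    have "continuous_map (factor_topology Fac_T) euclidean (\<lambda>x. cis (2 * pi * x))"
      by (rule continuous_map_from_factor_T) simp
    \<comment> \<open>The exponent \<open>n\<close> may be negative, so the power map is used only
      away from 0.\<close>
    then have "continuous_map (factor_topology Fac_T) (top_of_set (- {0})) (\<lambda>x. cis (2 * pi * x))"
      by (auto simp: continuous_map_in_subtopology)
    moreover have "continuous_map (top_of_set (- {0})) euclidean (\<lambda>z::complex. z powi n)"
      by (auto intro!: continuous_intros)
    ultimately have "continuous_map (factor_topology Fac_T) euclidean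
        ((\<lambda>z. z powi n) \<circ> (\<lambda>x. cis (2 * pi * x)))"
      by (rule continuous_map_compose)
    moreover have "cis (2 * pi * x) powi n = cis (2 * pi * (a * x))" for x
      by (simp add: cis_power_int n mult_ac)
    ultimately have "continuous_map (factor_topology Fac_T) euclidean (\<lambda>x. cis (2 * pi * (a * x)))"
      by (simp add: o_def)
    from continuous_map_into_factor_T[OF this] show ?thesis
      using 3 by simp
  qed
qed

text \<open>Continuity is assumed of the reduced summands, since \<open>f j\<close> itself may leave
  the carrier; \<open>rmod_add\<close> absorbs the intermediate reductions.\<close>

lemma continuous_map_factor_sum:
  assumes X: "elementary [X]"
    and f: "\<And>j. j \<in> S \<Longrightarrow> continuous_map T (factor_topology X) (\<lambda>x. f j x rmod real (char X))"
  shows "continuous_map T (factor_topology X) (\<lambda>x. (\<Sum>j\<in>S. f j x) rmod real (char X))"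
  using f
proof (induction S rule: infinite_finite_induct)
  case (insert j S)
  then show ?case
    using continuous_map_factor_add[OF X, of T "\<lambda>x. f j x rmod real (char X)"
        "\<lambda>x. (\<Sum>j\<in>S. f j x) rmod real (char X)"]
    by (simp add: rmod_add)
next
  case empty
  show ?case using rmod_in_factor_carrier[OF X, of 0] by (simp add: topspace_factor_topology)
next
  case infinite
  then show ?case using rmod_in_factor_carrier[OF X, of 0] by (simp add: topspace_factor_topology)
qed

section \<open>Sufficiency: the homomorphism induced by an admissible matrix\<close>

text \<open>Reduction selects the canonical representative in each factor; restricting the index
  range makes the value an extensional function, as the product carrier demands.\<close>

definition mat_hom :: "factor list \<Rightarrow> factor list \<Rightarrow> real mat \<Rightarrow> (nat \<Rightarrow> real) \<Rightarrow> (nat \<Rightarrow> real)" where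
  "mat_hom G H A g =
     (\<lambda>i\<in>{..<length H}. (\<Sum>j<length G. A $$ (i, j) * g j) rmod real (char (H ! i)))"

lemma carrier_elem_group: "carrier (elem_group G) = (\<Pi>\<^sub>E i\<in>{..<length G}. factor_carrier (G ! i))"
  by (simp add: elem_group_def factor_group_def)

lemma continuous_hom_mat_hom:
  assumes G: "elementary G" and H: "elementary H"
    and adm: "\<And>i j. i < length H \<Longrightarrow> j < length G \<Longrightarrow> admissible (H ! i) (G ! j) (A $$ (i, j))"
  shows "continuous_hom G H (mat_hom G H A)"
proof -
  let ?c = "\<lambda>j. real (char (G ! j))" and ?d = "\<lambda>i. real (char (H ! i))"
  have mem: "mat_hom G H A g \<in> carrier (elem_group H)" if g: "g \<in> carrier (elem_group G)" for g
  proof -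
    have "(\<Sum>j<length G. A $$ (i, j) * g j) \<in> \<int>" if "i < length H" "discrete_factor (H ! i)" for i
      using that g admissible_mult_Ints[OF adm[OF that(1)] that(2)]
      by (intro Ints_sum) (auto simp: carrier_elem_group)
    then show ?thesis
      by (auto simp: carrier_elem_group mat_hom_def discrete_factor_def
          intro!: rmod_in_factor_carrier elementary_nth[OF H])
  qed
  have "mat_hom G H A (g \<otimes>\<^bsub>elem_group G\<^esub> h) =
      mat_hom G H A g \<otimes>\<^bsub>elem_group H\<^esub> mat_hom G H A h" for g h
  proof
    fix i
    show "mat_hom G H A (g \<otimes>\<^bsub>elem_group G\<^esub> h) i =
      (mat_hom G H A g \<otimes>\<^bsub>elem_group H\<^esub> mat_hom G H A h) i"
    proof (cases "i < length H")
      case True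
      \<comment> \<open>Addition in the source reduces modulo \<open>?c j\<close>; admissibility
        makes this invisible modulo \<open>?d i\<close>.\<close>
      have "[\<Sum>j<length G. A $$ (i, j) * ((g j + h j) rmod ?c j) =
             \<Sum>j<length G. A $$ (i, j) * (g j + h j)] (rmod ?d i)"
        using adm[OF True] by (intro rcong_sum) (auto intro!: admissible_rcong_mult rcong_rmod_left)
      then show ?thesis
        using True by (simp add: mat_hom_def elem_group_def factor_group_def rmod_add
            rcong_imp_rmod_eq distrib_left sum.distrib)
    qed (simp add: mat_hom_def elem_group_def)
  qed
  with mem have "mat_hom G H A \<in> hom (elem_group G) (elem_group H)"
    by (simp add: hom_def)
  moreover have "continuous_map (elem_topology G) (elem_topology H) (mat_hom G H A)"
  proof -
    have "continuous_map (elem_topology G) (factor_topology (H ! i)) (\<lambda>g. mat_hom G H A g i)"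
      if i: "i < length H" for i
    proof -
      have "continuous_map (elem_topology G) (factor_topology (H ! i)) (\<lambda>g. (A $$ (i, j) * g j) rmod ?d i)"
        if j: "j < length G" for j
      proof -
        have "continuous_map (elem_topology G) (factor_topology (G ! j)) (\<lambda>g. g j)"
          unfolding elem_topology_def using j by (intro continuous_map_product_projection) simp
        from continuous_map_compose[OF this continuous_map_factor_mult[OF elementary_nth[OF H i]
              elementary_nth[OF G j] adm[OF i j]]]
        show ?thesis by (simp add: o_def)
      qed
      then show ?thesis
        using i by (auto simp: mat_hom_def intro!: continuous_map_factor_sum elementary_nth[OF H i])
    qed
    then show ?thesis
      unfolding elem_topology_def
      by (auto simp: continuous_map_componentwise mat_hom_def)
  qed
  ultimately show ?thesis by (simp add: continuous_hom_def)
qed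

lemma mult_mat_vec_index_sum:
  assumes "A \<in> carrier_mat n m" "x \<in> carrier_vec m" "i < n"
  shows "(A *\<^sub>v x) $ i = (\<Sum>j<m. A $$ (i, j) * x $ j)"
  using assms by (auto simp: scalar_prod_def lessThan_atLeast0)

text \<open>A real lift \<open>x\<close> of \<open>g\<close> differs from it by multiples of the
  source characteristics, which admissible entries send to multiples of the target ones.\<close>

lemma matrix_rep_mat_hom:
  assumes A: "A \<in> carrier_mat (length H) (length G)"
    and adm: "\<And>i j. i < length H \<Longrightarrow> j < length G \<Longrightarrow> admissible (H ! i) (G ! j) (A $$ (i, j))"
  shows "matrix_rep G H (mat_hom G H A) A"
  unfolding matrix_rep_def
proof (intro conjI ballI impI)
  fix g x assume x: "x \<in> carrier_vec (length G)" and xg: "tuple_cong G (($) x) g"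
  show "tuple_cong H (mat_hom G H A g) (($) (A *\<^sub>v x))"
    unfolding tuple_cong_def
  proof (intro allI impI)
    fix i assume i: "i < length H"
    have "[\<Sum>j<length G. A $$ (i, j) * g j = \<Sum>j<length G. A $$ (i, j) * x $ j] (rmod real (char (H ! i)))"
      using xg adm[OF i]
      by (intro rcong_sum admissible_rcong_mult) (auto simp: tuple_cong_def rcong_sym_iff)
    then show "[mat_hom G H A g i = (A *\<^sub>v x) $ i] (rmod real (char (H ! i)))"
      using i by (simp add: mat_hom_def mult_mat_vec_index_sum[OF A x i] rcong_rmod_left del: index_mult_mat_vec)
  qed
qed (rule A)

section \<open>Necessity: evaluation on multiples of unit vectors\<close>

lemma rcong_Ints: "[x = y] (rmod real n) \<Longrightarrow> x \<in> \<int> \<Longrightarrow> y \<in> \<int>"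
  by (auto simp: rcong_altdef)

lemma matrix_rep_imp_admissible:
  assumes G: "elementary G" and H: "elementary H"
    and hom: "\<alpha> \<in> hom (elem_group G) (elem_group H)" and rep: "matrix_rep G H \<alpha> A"
    and i: "i < length H" and j: "j < length G"
  shows "admissible (H ! i) (G ! j) (A $$ (i, j))"
proof -
  let ?a = "A $$ (i, j)" and ?m = "length G"
  let ?c = "real (char (G ! j))" and ?d = "real (char (H ! i))"
  have A: "A \<in> carrier_mat (length H) ?m"
    using rep by (simp add: matrix_rep_def)
  interpret GH: group_hom "elem_group G" "elem_group H" \<alpha>
    using comm_group_elem_group[OF G] comm_group_elem_group[OF H] hom
    by (simp add: group_hom_def group_hom_axioms_def comm_group_def)
  have one: "\<one>\<^bsub>elem_group K\<^esub> = (\<lambda>i\<in>{..<length K}. 0)" for K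
    by (simp add: elem_group_def factor_group_def)
  \<comment> \<open>The canonical representative of \<open>t\<close> times the unit vector at
    \<open>j\<close>.\<close>
  define g where "g = (\<lambda>t. \<lambda>k\<in>{..<?m}. if k = j then t rmod ?c else 0)"
  have rep_t: "[\<alpha> (g t) i = t * ?a] (rmod ?d)" if g: "g t \<in> carrier (elem_group G)" for t
  proof -
    define x where "x = t \<cdot>\<^sub>v unit_vec ?m j"
    have x: "x \<in> carrier_vec ?m" by (simp add: x_def)
    have "tuple_cong G (($) x) (g t)"
      using j by (auto simp: tuple_cong_def x_def g_def)
    then have "[\<alpha> (g t) i = (A *\<^sub>v x) $ i] (rmod ?d)"
      using rep g x i by (auto simp: matrix_rep_def tuple_cong_def)
    moreover have "(A *\<^sub>v x) $ i = t * ?a"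
      using A i j by (simp add: x_def)
    ultimately show ?thesis by simp
  qed
  \<comment> \<open>The choice \<open>t = ?c\<close> reduces to 0, also when \<open>?c\<close> is 0,
    so \<open>\<alpha>\<close> sends it to the identity.\<close>
  have "g ?c = \<one>\<^bsub>elem_group G\<^esub>"
    by (auto simp: g_def one)
  then have "[?c * ?a = 0] (rmod ?d)"
    using rep_t[of ?c] i GH.hom_one GH.G.one_closed by (simp add: one rcong_sym_iff)
  \<comment> \<open>A discrete source admits only integral \<open>t\<close>; any other source admits
    every real \<open>t\<close>.\<close>
  moreover have int: "t * ?a \<in> \<int>" if "discrete_factor (H ! i)" "discrete_factor (G ! j) \<Longrightarrow> t \<in> \<int>" for t
  proof -
    have "t rmod ?c \<in> factor_carrier (G ! j)"
      using that(2) by (intro rmod_in_factor_carrier elementary_nth[OF G j]) (auto simp: discrete_factor_def)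
    moreover have "0 \<in> factor_carrier (G ! k)" if "k < ?m" for k
      using rmod_in_factor_carrier[OF elementary_nth[OF G that], of 0] by simp
    ultimately have g: "g t \<in> carrier (elem_group G)"
      by (auto simp: carrier_elem_group g_def)
    then have "\<alpha> (g t) i \<in> factor_carrier (H ! i)"
      using GH.hom_closed[OF g] i by (auto simp: carrier_elem_group)
    then have "\<alpha> (g t) i \<in> \<int>"
      using that(1) by (auto simp: discrete_factor_def)
    with rep_t[OF g] show ?thesis by (rule rcong_Ints)
  qed
  moreover have "?a = 0" if "discrete_factor (H ! i)" "\<not> discrete_factor (G ! j)"
  proof (rule ccontr)
    assume "?a \<noteq> 0"
    \<comment> \<open>The witness \<open>t = 1 / (2 * ?a)\<close> makes the product
      \<open>t * ?a\<close> equal to one half.\<close>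
    then have "1 / 2 \<in> (\<int> :: real set)"
      using int[of "1 / (2 * ?a)"] that by simp
    then show False
      by (auto elim!: Ints_cases simp: field_simps)
  qed
  ultimately show ?thesis
    using int[of 1] by (auto simp: admissible_def)
qed

section \<open>The block normal form\<close>

lemma F_part_nth:
  assumes "elementary G" "i < length (F_part G)"
  obtains N where "0 < N" "F_part G ! i = Fac_Zmod N"
  using assms nth_mem[OF assms(2)] by (auto simp: F_part_def elementary_def)

text \<open>Passing the factor to \<open>P\<close> separately from its index exposes the literal
  factor in each range, so that the rules for \<open>admissible\<close> apply to rows and columns
  alike.\<close>

lemma all_ordered_factors_iff:
  assumes "ordered_factors G"
  shows "(\<forall>i<length G. P i (G ! i)) \<longleftrightarrow>
    (\<forall>i<length (Z_part G). P i Fac_Z) \<and>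
    (\<forall>i<length (R_part G). P (length (Z_part G) + i) Fac_R) \<and>
    (\<forall>i<length (F_part G). P (length (Z_part G) + length (R_part G) + i) (F_part G ! i)) \<and>
    (\<forall>i<length (T_part G).
       P (length (Z_part G) + length (R_part G) + length (F_part G) + i) Fac_T)"
proof -
  define Z R F T where "Z = Z_part G" and "R = R_part G" and "F = F_part G" and "T = T_part G"
  have nth: "i < length Z \<Longrightarrow> Z ! i = Fac_Z" "i < length R \<Longrightarrow> R ! i = Fac_R"
    "i < length T \<Longrightarrow> T ! i = Fac_T" for i
    using nth_mem[of i Z] nth_mem[of i R] nth_mem[of i T]
    by (auto simp: Z_def Z_part_def R_def R_part_def T_def T_part_def)
  have G: "G = Z @ R @ F @ T"
    using assms by (simp add: ordered_factors_def Z_def R_def F_def T_def)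
  have split: "(\<forall>i<k + l. Q i) \<longleftrightarrow> (\<forall>i<k. Q i) \<and> (\<forall>i<l. Q (k + i))" for k l :: nat and Q
    by (metis add_less_cancel_left le_Suc_ex not_less trans_less_add1)
  show ?thesis
    unfolding Z_def[symmetric] R_def[symmetric] F_def[symmetric] T_def[symmetric]
    by (simp add: G split nth_append nth add.assoc)
qed

lemma elements_mat_subset_iff:
  assumes "A \<in> carrier_mat r c"
  shows "elements_mat A \<subseteq> S \<longleftrightarrow> (\<forall>i<r. \<forall>j<c. A $$ (i, j) \<in> S)"
  using assms by fastforce

text \<open>Turns the integers found entry by entry into the single coefficient function required by
  \<open>normal_form\<close>.\<close>

lemma bounded_choice2:
  fixes m n :: nat
  assumes "\<forall>i<m. \<forall>j<n. \<exists>k. P i j k"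
  obtains f where "\<forall>i<m. \<forall>j<n. P i j (f i j)"
proof -
  have "\<forall>i<m. \<forall>j<n. P i j (SOME k. P i j k)"
    using assms by (auto intro: someI)
  with that show thesis .
qed

lemma admissible_F_part [simp]:
  assumes "elementary G" "i < length (F_part G)"
  shows "admissible Fac_Z (F_part G ! i) a \<longleftrightarrow> a = 0"
    "admissible Fac_R (F_part G ! i) a \<longleftrightarrow> a = 0"
    "admissible (F_part G ! i) Fac_Z a \<longleftrightarrow> a \<in> \<int>"
    "admissible (F_part G ! i) Fac_R a \<longleftrightarrow> a = 0"
    "admissible (F_part G ! i) Fac_T a \<longleftrightarrow> a = 0"
    "admissible Fac_T (F_part G ! i) a \<longleftrightarrow> (\<exists>k::int. a = of_int k / real (char (F_part G ! i)))"
  by (rule F_part_nth[OF assms]; simp)+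

lemma admissible_F_part_F_part [simp]:
  assumes "elementary G" "elementary H" "i < length (F_part H)" "j < length (F_part G)"
  shows "admissible (F_part H ! i) (F_part G ! j) a \<longleftrightarrow>
    (\<exists>k::int. a = of_int k *
       (real (char (F_part H ! i)) / real (gcd (char (F_part H ! i)) (char (F_part G ! j)))))"
  by (rule F_part_nth[OF assms(1,4)], rule F_part_nth[OF assms(2,3)]) simp

text \<open>Splitting rows and columns by type turns admissibility into one condition per block. One
  direction reads these off the given blocks; the other cuts the blocks out of \<open>A\<close> and
  reassembles them.\<close>

lemma normal_form_iff_admissible:
  assumes G: "elementary G" "ordered_factors G" and H: "elementary H" "ordered_factors H"
    and A: "A \<in> carrier_mat (length H) (length G)"
  shows "normal_form G H A \<longleftrightarrow>
    (\<forall>i<length H. \<forall>j<length G. admissible (H ! i) (G ! j) (A $$ (i, j)))"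
proof -
  define gZ gR gF gT where "gZ = length (Z_part G)" and "gR = length (R_part G)"
    and "gF = length (F_part G)" and "gT = length (T_part G)"
  define hZ hR hF hT where "hZ = length (Z_part H)" and "hR = length (R_part H)"
    and "hF = length (F_part H)" and "hT = length (T_part H)"
  note lengths = gZ_def[symmetric] gR_def[symmetric] gF_def[symmetric] gT_def[symmetric]
    hZ_def[symmetric] hR_def[symmetric] hF_def[symmetric] hT_def[symmetric]
  have mG: "length G = gZ + gR + gF + gT"
    using arg_cong[OF G(2)[unfolded ordered_factors_def], of length] by (simp add: lengths)
  have nH: "length H = hZ + hR + hF + hT"
    using arg_cong[OF H(2)[unfolded ordered_factors_def], of length] by (simp add: lengths)
  note all_rows = all_ordered_factors_iff[OF H(2), unfolded lengths]
  note all_cols = all_ordered_factors_iff[OF G(2), unfolded lengths]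
  note adm_F = admissible_F_part[OF G(1), unfolded lengths] admissible_F_part[OF H(1), unfolded lengths]
    admissible_F_part_F_part[OF G(1) H(1), unfolded lengths]
  let ?adm = "\<forall>i<length H. \<forall>j<length G. admissible (H ! i) (G ! j) (A $$ (i, j))"
  \<comment> \<open>The blocks RZ, RR, TZ and TR are unrestricted and leave no conjunct.\<close>
  have adm_blocks: "?adm \<longleftrightarrow>
    (\<forall>i<hZ. (\<forall>j<gZ. A $$ (i, j) \<in> \<int>) \<and> (\<forall>j<gR. A $$ (i, gZ + j) = 0) \<and>
       (\<forall>j<gF. A $$ (i, gZ + gR + j) = 0) \<and> (\<forall>j<gT. A $$ (i, gZ + gR + gF + j) = 0)) \<and>
    (\<forall>i<hR. (\<forall>j<gF. A $$ (hZ + i, gZ + gR + j) = 0) \<and>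
       (\<forall>j<gT. A $$ (hZ + i, gZ + gR + gF + j) = 0)) \<and>
    (\<forall>i<hF. (\<forall>j<gZ. A $$ (hZ + hR + i, j) \<in> \<int>) \<and> (\<forall>j<gR. A $$ (hZ + hR + i, gZ + j) = 0) \<and>
       (\<forall>j<gF. \<exists>k::int. A $$ (hZ + hR + i, gZ + gR + j) = of_int k *
         (real (char (F_part H ! i)) / real (gcd (char (F_part H ! i)) (char (F_part G ! j))))) \<and>
       (\<forall>j<gT. A $$ (hZ + hR + i, gZ + gR + gF + j) = 0)) \<and>
    (\<forall>i<hT.
       (\<forall>j<gF. \<exists>k::int. A $$ (hZ + hR + hF + i, gZ + gR + j) =
         of_int k / real (char (F_part G ! j))) \<and>
       (\<forall>j<gT. A $$ (hZ + hR + hF + i, gZ + gR + gF + j) \<in> \<int>))" (is "_ \<longleftrightarrow> ?blocks")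
    unfolding all_rows[of "\<lambda>i X. \<forall>j<length G. admissible X (G ! j) (A $$ (i, j))"]
    unfolding all_cols[of "\<lambda>j Y. admissible X Y (A $$ (i, j))" for X i]
    by (simp add: adm_F cong: conj_cong)
  show ?thesis
  proof
    assume "normal_form G H A"
    then show ?adm
      unfolding adm_blocks unfolding normal_form_def Let_def lengths
      by (elim bexE conjE) (simp add: elements_mat_subset_iff, blast)
  next
    assume ?adm
    then have adm: ?blocks
      unfolding adm_blocks .
    then have FF: "\<forall>i<hF. \<forall>j<gF. \<exists>k::int. A $$ (hZ + hR + i, gZ + gR + j) = of_int k *
         (real (char (F_part H ! i)) / real (gcd (char (F_part H ! i)) (char (F_part G ! j))))"
      and TF: "\<forall>i<hT. \<forall>j<gF. \<exists>k::int. A $$ (hZ + hR + hF + i, gZ + gR + j) =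
         of_int k / real (char (F_part G ! j))"
      by blast+
    from bounded_choice2[OF FF] bounded_choice2[OF TF]
    obtain \<alpha> \<beta> where \<alpha>: "\<forall>i<hF. \<forall>j<gF. A $$ (hZ + hR + i, gZ + gR + j) = of_int (\<alpha> i j) *
         (real (char (F_part H ! i)) / real (gcd (char (F_part H ! i)) (char (F_part G ! j))))"
      and \<beta>: "\<forall>i<hT. \<forall>j<gF. A $$ (hZ + hR + hF + i, gZ + gR + j) =
         of_int (\<beta> i j) / real (char (F_part G ! j))"
      by metis
    \<comment> \<open>The submatrix of \<open>A\<close> with \<open>r\<close> rows and
      \<open>c\<close> columns whose top left corner is at \<open>(i0, j0)\<close>.\<close>
    define B where "B = (\<lambda>r c i0 j0. mat r c (\<lambda>(i, j). A $$ (i0 + i, j0 + j)))"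
    have B: "B r c i0 j0 \<in> carrier_mat r c" for r c i0 j0
      by (simp add: B_def)
    have Bij: "B r c i0 j0 $$ (i, j) = A $$ (i0 + i, j0 + j)" if "i < r" "j < c" for r c i0 j0 i j
      using that by (simp add: B_def)
    have A_eq: "A = four_block_mat
        (four_block_mat (B hZ gZ 0 0) (0\<^sub>m hZ gR) (B hR gZ hZ 0) (B hR gR hZ gZ))
        (four_block_mat (0\<^sub>m hZ gF) (0\<^sub>m hZ gT) (0\<^sub>m hR gF) (0\<^sub>m hR gT))
        (four_block_mat (B hF gZ (hZ + hR) 0) (0\<^sub>m hF gR)
           (B hT gZ (hZ + hR + hF) 0) (B hT gR (hZ + hR + hF) gZ))
        (four_block_mat (B hF gF (hZ + hR) (gZ + gR)) (0\<^sub>m hF gT)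
           (B hT gF (hZ + hR + hF) (gZ + gR)) (B hT gT (hZ + hR + hF) (gZ + gR + gF)))"
      (is "A = ?M")
    proof (rule eq_matI)
      \<comment> \<open>Quantified this way, the entrywise equality splits by
        \<open>all_rows\<close> and \<open>all_cols\<close> into blocks, where \<open>adm\<close>
        supplies the zeros.\<close>
      have "\<forall>i<length H. \<forall>j<length G. A $$ (i, j) = ?M $$ (i, j)"
        unfolding all_rows[of "\<lambda>i X. \<forall>j<length G. A $$ (i, j) = ?M $$ (i, j)"]
        unfolding all_cols[of "\<lambda>j Y. A $$ (i, j) = ?M $$ (i, j)" for i]
        using adm by (simp add: B_def)
      then show "A $$ (i, j) = ?M $$ (i, j)" if "i < dim_row ?M" "j < dim_col ?M" for i j
        using that by (simp add: nH mG B_def)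
    qed (use A in \<open>simp_all add: nH mG B_def\<close>)
    have ints: "elements_mat (B hZ gZ 0 0) \<subseteq> \<int>"
      "elements_mat (B hT gT (hZ + hR + hF) (gZ + gR + gF)) \<subseteq> \<int>"
      "elements_mat (B hF gZ (hZ + hR) 0) \<subseteq> \<int>"
      using adm by (simp_all add: elements_mat_subset_iff[OF B] Bij)
    have "\<exists>\<alpha>. \<forall>i<hF. \<forall>j<gF. B hF gF (hZ + hR) (gZ + gR) $$ (i, j) = of_int (\<alpha> i j) *
         (real (char (F_part H ! i)) / real (gcd (char (F_part H ! i)) (char (F_part G ! j))))"
      by (rule exI[of _ \<alpha>]) (use \<alpha> in \<open>simp add: Bij\<close>)
    moreover have "\<exists>\<alpha>. \<forall>i<hT. \<forall>j<gF. B hT gF (hZ + hR + hF) (gZ + gR) $$ (i, j) =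
         of_int (\<alpha> i j) / real (char (F_part G ! j))"
      by (rule exI[of _ \<beta>]) (use \<beta> in \<open>simp add: Bij\<close>)
    ultimately show "normal_form G H A"
      unfolding normal_form_def Let_def lengths
      \<comment> \<open>The goal fixes the size of each witness \<open>B\<close>; its corner stays
        schematic until \<open>A_eq\<close> determines it.\<close>
      by - (assumption | rule bexI[OF _ B] conjI A_eq ints)+
  qed
qed

theorem lemma8:
  fixes G H :: "factor list" and A :: "real mat"
  assumes "elementary G" and "elementary H"
    and "ordered_factors G" and "ordered_factors H"
    and "A \<in> carrier_mat (length H) (length G)"
  shows "((\<exists>\<alpha>. continuous_hom G H \<alpha> \<and> matrix_rep G H \<alpha> A) \<longleftrightarrow>
            A \<in> Rep G H \<and> consistent G H A) \<and>
         (A \<in> Rep G H \<and> consistent G H A \<longleftrightarrow> normal_form G H A)"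
proof -
  let ?adm = "\<forall>i<length H. \<forall>j<length G. admissible (H ! i) (G ! j) (A $$ (i, j))"
  have "(\<exists>\<alpha>. continuous_hom G H \<alpha> \<and> matrix_rep G H \<alpha> A) \<longleftrightarrow> ?adm"
  proof
    assume "\<exists>\<alpha>. continuous_hom G H \<alpha> \<and> matrix_rep G H \<alpha> A"
    then show ?adm
      using matrix_rep_imp_admissible[OF assms(1,2)] by (auto simp: continuous_hom_def)
  next
    assume ?adm
    then have "continuous_hom G H (mat_hom G H A)" "matrix_rep G H (mat_hom G H A) A"
      using assms by (auto intro: continuous_hom_mat_hom matrix_rep_mat_hom)
    then show "\<exists>\<alpha>. continuous_hom G H \<alpha> \<and> matrix_rep G H \<alpha> A" by blast
  qed
  then show ?thesis
    using assms by (simp add: Rep_consistent_iff_admissible normal_form_iff_admissible)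
qed

end
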